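(* Let $\psi$ be a 3-CNF formula and let $G_\psi$ be the signed digraph constructed from it as described in the context. The following are equivalent: 1. $\psi$ is not satisfiable; 2. every Boolean network on $G_\psi$ has at most one fixed point; 3. there is a word of length $12n+12m+11$ which synchronizes every Boolean network on $G_\psi$; 4. every Boolean network on $G_\psi$ is synchronizing.
   Context: $\psi$ is a 3-CNF formula over variables $\lambda_1,\dots,\lambda_n$ ($n\ge 2$) with clauses $\mu_1,\dots,\mu_m$ ($m\ge1$). Each variable $\lambda_r$ has a positive literal $\lambda_r^+$ and a negative literal $\lambda_r^-$; each clause is a set of three literals, written $\mu_s=\{\mu_{s,1},\mu_{s,2},\mu_{s,3}\}$ in a fixed order. An assignment $z\in\{0,1\}^n$ satisfies $\lambda_r^+$ if $z_r=1$ and $\lambda_r^-$ if $z_r=0$; $\psi$ is satisfiable if some $z$ satisfies a literal in every clause. $H_\psi$ is the signed digraph with vertices: all literals $\lambda_r^\pm$, $\ell_0,\dots,\ell_n$, $\mu'_1,\dots,\mu'_m$, $\mu_1,\dots,\mu_m$, $c_1,\dots,c_m$; arcs, for $r\in[n]$, $s\in[m]$: $(\ell_{r-1},\lambda_r^+),(\ell_{r-1},\lambda_r^-),(\lambda_r^+,\ell_r),(\lambda_r^-,\ell_r)$, $(c_1,\ell_0)$, $(\mu_{s,1},\mu'_s),(\mu_{s,2},\mu'_s),(\mu_{s,3},\mu_s),(\mu'_s,\mu_s)$ (here $\mu_{s,k}$ denotes the literal vertex), $(\mu_s,c_s)$, and $(c_{s+1},c_s)$ where $c_{m+1}$ means $\ell_n$.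 The arcs $(\mu_s,c_s)$ are negative, all others positive. $G_\psi$ is obtained from $H_\psi$ by adding two new vertices $q,t$, a negative arc $(\ell_0,q)$, positive arcs $(\ell_0,t),(q,t)$, and a positive arc $(t,i)$ for every literal vertex $i$. A signed digraph is $(V,E)$ with $E\subseteq V\times V\times\{-1,1\}$. A Boolean network (BN) is $f:\{0,1\}^V\to\{0,1\}^V$; its signed interaction digraph has a positive (negative) arc from $j$ to $i$ iff for some $x$ with $x_j=0$, $f_i(x+e_j)-f_i(x)$ is positive (negative); a BN on $G$ is one whose signed interaction digraph is $G$. A fixed point is $x$ with $f(x)=x$. $f^i(x)$ is $x$ with $x_i$ replaced by $f_i(x)$; $f^{i_1\cdots i_\ell}=f^{i_\ell}\circ\cdots\circ f^{i_1}$; $w$ synchronizes $f$ if $f^w$ is constant; $f$ is synchronizing if some word synchronizes it. *)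

theory Defs
  imports Main
begin

text \<open>A signed digraph is a set of triples (j, i, s) with s in {-1, 1}.
  A configuration on vertex set V is a Boolean function that is False outside V.
  A BN on V is a function f; only its values f x i for x in configs V and i in V matter.\<close>

type_synonym 'v sdigraph = "('v \<times> 'v \<times> int) set"

definition configs :: "'v set \<Rightarrow> ('v \<Rightarrow> bool) set" where
  "configs V = {x. \<forall>v. v \<notin> V \<longrightarrow> x v = False}"

definition interaction_graph :: "'v set \<Rightarrow> (('v \<Rightarrow> bool) \<Rightarrow> 'v \<Rightarrow> bool) \<Rightarrow> 'v sdigraph" where
  "interaction_graph V f = {(j, i, s). j \<in> V \<and> i \<in> V \<and>
     (\<exists>x \<in> configs V. \<not> x j \<and>
        ((s = 1 \<and> \<not> f x i \<and> f (x(j := True)) i) \<or>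
         (s = -1 \<and> f x i \<and> \<not> f (x(j := True)) i)))}"

definition BN_on :: "'v set \<Rightarrow> 'v sdigraph \<Rightarrow> (('v \<Rightarrow> bool) \<Rightarrow> 'v \<Rightarrow> bool) \<Rightarrow> bool" where
  "BN_on V G f \<longleftrightarrow> interaction_graph V f = G"

definition fixed_point :: "'v set \<Rightarrow> (('v \<Rightarrow> bool) \<Rightarrow> 'v \<Rightarrow> bool) \<Rightarrow> ('v \<Rightarrow> bool) \<Rightarrow> bool" where
  "fixed_point V f x \<longleftrightarrow> x \<in> configs V \<and> (\<forall>i \<in> V. f x i = x i)"

definition upd :: "(('v \<Rightarrow> bool) \<Rightarrow> 'v \<Rightarrow> bool) \<Rightarrow> 'v \<Rightarrow> ('v \<Rightarrow> bool) \<Rightarrow> ('v \<Rightarrow> bool)" where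
  "upd f i x = x(i := f x i)"

fun upd_word :: "(('v \<Rightarrow> bool) \<Rightarrow> 'v \<Rightarrow> bool) \<Rightarrow> 'v list \<Rightarrow> ('v \<Rightarrow> bool) \<Rightarrow> ('v \<Rightarrow> bool)" where
  "upd_word f [] x = x"
| "upd_word f (i # w) x = upd_word f w (upd f i x)"

definition synchronizes :: "'v set \<Rightarrow> (('v \<Rightarrow> bool) \<Rightarrow> 'v \<Rightarrow> bool) \<Rightarrow> 'v list \<Rightarrow> bool" where
  "synchronizes V f w \<longleftrightarrow> set w \<subseteq> V \<and> (\<exists>y. \<forall>x \<in> configs V. upd_word f w x = y)"

definition synchronizing :: "'v set \<Rightarrow> (('v \<Rightarrow> bool) \<Rightarrow> 'v \<Rightarrow> bool) \<Rightarrow> bool" where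
  "synchronizing V f \<longleftrightarrow> (\<exists>w. synchronizes V f w)"

text \<open>A 3-CNF over variables 1..n with clauses 1..m is given by cl :: nat => nat => nat * bool;
  cl s k (k in {1,2,3}) is the k-th literal of clause s, (r, True) = positive literal of
  variable r, (r, False) = negative literal.\<close>

definition wf_3cnf :: "nat \<Rightarrow> nat \<Rightarrow> (nat \<Rightarrow> nat \<Rightarrow> nat \<times> bool) \<Rightarrow> bool" where
  "wf_3cnf n m cl \<longleftrightarrow> (\<forall>s \<in> {1..m}. (\<forall>k \<in> {1..3}. fst (cl s k) \<in> {1..n}) \<and> inj_on (cl s) {1..3})"

definition satisfiable :: "nat \<Rightarrow> (nat \<Rightarrow> nat \<Rightarrow> nat \<times> bool) \<Rightarrow> bool" where
  "satisfiable m cl \<longleftrightarrow> (\<exists>z :: nat \<Rightarrow> bool. \<forall>s \<in> {1..m}. \<exists>k \<in> {1..3}. z (fst (cl s k)) = snd (cl s k))"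

datatype vtx = Lit nat bool | Ell nat | MuP nat | Mu nat | Cv nat | Qv | Tv

definition lit_vtx :: "nat \<times> bool \<Rightarrow> vtx" where
  "lit_vtx l = Lit (fst l) (snd l)"

definition V_G :: "nat \<Rightarrow> nat \<Rightarrow> vtx set" where
  "V_G n m = {Lit r b | r b. r \<in> {1..n}} \<union> Ell ` {0..n} \<union> MuP ` {1..m} \<union> Mu ` {1..m}
            \<union> Cv ` {1..m} \<union> {Qv, Tv}"

definition cv :: "nat \<Rightarrow> nat \<Rightarrow> nat \<Rightarrow> vtx" where
  "cv n m s = (if s = m + 1 then Ell n else Cv s)"

definition H_psi :: "nat \<Rightarrow> nat \<Rightarrow> (nat \<Rightarrow> nat \<Rightarrow> nat \<times> bool) \<Rightarrow> vtx sdigraph" where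
  "H_psi n m cl =
     {(Ell (r - 1), Lit r b, 1) | r b. r \<in> {1..n}}
   \<union> {(Lit r b, Ell r, 1) | r b. r \<in> {1..n}}
   \<union> {(Cv 1, Ell 0, 1)}
   \<union> {(lit_vtx (cl s 1), MuP s, 1) | s. s \<in> {1..m}}
   \<union> {(lit_vtx (cl s 2), MuP s, 1) | s. s \<in> {1..m}}
   \<union> {(lit_vtx (cl s 3), Mu s, 1) | s. s \<in> {1..m}}
   \<union> {(MuP s, Mu s, 1) | s. s \<in> {1..m}}
   \<union> {(Mu s, Cv s, -1) | s. s \<in> {1..m}}
   \<union> {(cv n m (s + 1), Cv s, 1) | s. s \<in> {1..m}}"

definition G_psi :: "nat \<Rightarrow> nat \<Rightarrow> (nat \<Rightarrow> nat \<Rightarrow> nat \<times> bool) \<Rightarrow> vtx sdigraph" where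
  "G_psi n m cl = H_psi n m cl
   \<union> {(Ell 0, Qv, -1), (Ell 0, Tv, 1), (Qv, Tv, 1)}
   \<union> {(Tv, Lit r b, 1) | r b. r \<in> {1..n}}"

end

theory Submission
  imports Defs
begin

text \<open>
  Every gate of a network on $G_\psi$ with two in-neighbours is a conjunction or a disjunction of
  signed inputs, and $\ell_0$ meets every cycle. Hence two distinct fixed points differ at
  $\ell_0$, and in every variable some literal vertex differs; following the difference around the
  cycle through the $c_s$ shows that the three literals of a clause cannot all differ, so choosing
  from each variable a literal that does not differ (if there is one) satisfies $\psi$.

  For synchronization, updating all vertices but $\ell_0$ in topological order produces a state
  \<open>F a\<close> that depends only on the value \<open>a\<close> of $\ell_0$. Let \<open>h a\<close> be the value of $c_1$ in
  \<open>F a\<close>. If \<open>h\<close> is the identity, there are two fixed points; if it is constant, the second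
  sweep reaches the fixed point. If \<open>h\<close> is the negation, $q$ and $t$ help: updating $t$ while $q$
  still remembers the negation of the previous value of $\ell_0$ copies $\ell_0$ to $t$, and
  updating $\ell_0$ then gives states in which $t$ is the negation of $\ell_0$. There, both
  literals of $\lambda_1$ take values that do not depend on the state, and so does everything
  updated after them.
\<close>

section \<open>Local functions of a network and its in-arcs\<close>

text \<open>The arcs into a vertex depend on its local function alone, so equality of signed
  digraphs is tested vertex by vertex.\<close>

definition in_arcs :: "'v sdigraph \<Rightarrow> 'v \<Rightarrow> ('v \<times> int) set" where
  "in_arcs G v = {(j, s). (j, v, s) \<in> G}"

lemma sdigraph_eq_iff: "G = G' \<longleftrightarrow> (\<forall>v. in_arcs G v = in_arcs G' v)"
  by (auto simp: in_arcs_def set_eq_iff)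

lemma configs_fun_upd: "x \<in> configs V \<Longrightarrow> v \<in> V \<Longrightarrow> x(v := b) \<in> configs V"
  by (auto simp: configs_def)

lemma in_arcs_interaction_graph:
  "(j, s) \<in> in_arcs (interaction_graph V f) v \<longleftrightarrow> j \<in> V \<and> v \<in> V \<and>
     (\<exists>x \<in> configs V. \<not> x j \<and>
        ((s = 1 \<and> \<not> f x v \<and> f (x(j := True)) v) \<or>
         (s = -1 \<and> f x v \<and> \<not> f (x(j := True)) v)))"
  by (simp add: in_arcs_def interaction_graph_def)

lemma no_arc_flip:
  assumes x: "x \<in> configs V" and j: "j \<in> V" and v: "v \<in> V"
    and no: "\<And>s. (j, s) \<notin> in_arcs (interaction_graph V f) v"
  shows "f (x(j := b)) v = f x v"
proof -
  let ?x0 = "x(j := False)"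
  have "?x0 \<in> configs V" using x j by (rule configs_fun_upd)
  with no[of 1] no[of "-1"] j v have "f (?x0(j := True)) v = f ?x0 v"
    unfolding in_arcs_interaction_graph by (metis fun_upd_same)
  then have eq: "f (x(j := True)) v = f (x(j := False)) v" by simp
  have "x(j := x j) = x" by simp
  with eq show ?thesis by (metis (full_types))
qed

text \<open>Turn \<open>x\<close> into \<open>y\<close> one differing vertex at a time. Such a
  vertex is not an in-neighbour of \<open>v\<close>, so no change is seen at
  \<open>v\<close>.\<close>

lemma local_function_cong:
  assumes "finite V" and "x \<in> configs V" and y: "y \<in> configs V" and v: "v \<in> V"
    and "\<And>j s. (j, s) \<in> in_arcs (interaction_graph V f) v \<Longrightarrow> x j = y j"
  shows "f x v = f y v"
  using assms(2,5)
proof (induction "card {j \<in> V. x j \<noteq> y j}" arbitrary: x rule: less_induct)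
  case less
  show ?case
  proof (cases "\<exists>j \<in> V. x j \<noteq> y j")
    case False
    with less.prems(1) y have "x = y" by (auto simp: configs_def fun_eq_iff)
    then show ?thesis by simp
  next
    case True
    then obtain j where j: "j \<in> V" "x j \<noteq> y j" by blast
    let ?x = "x(j := y j)"
    have "{i \<in> V. ?x i \<noteq> y i} \<subset> {i \<in> V. x i \<noteq> y i}" using j by auto
    then have "card {i \<in> V. ?x i \<noteq> y i} < card {i \<in> V. x i \<noteq> y i}"
      using \<open>finite V\<close> by (intro psubset_card_mono) auto
    moreover have "?x \<in> configs V" using less.prems(1) j(1) by (rule configs_fun_upd)
    ultimately have "f ?x v = f y v" using less.hyps less.prems(2) by fastforce
    moreover have "f ?x v = f x v"
      using less.prems j v by (intro no_arc_flip) auto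
    ultimately show ?thesis by simp
  qed
qed

definition signed :: "int \<Rightarrow> bool \<Rightarrow> bool" where
  "signed s b \<longleftrightarrow> (b \<longleftrightarrow> s = 1)"

lemma signed_simps [simp]: "signed 1 b = b" "signed (-1) b = (\<not> b)"
  by (simp_all add: signed_def)

lemma in_arcs_unary:
  assumes v: "v \<in> V" and u: "u \<in> V"
    and f: "\<forall>x \<in> configs V. f x v = \<phi> (x u)"
  shows "(j, s) \<in> in_arcs (interaction_graph V f) v \<longleftrightarrow>
    j = u \<and> (s = 1 \<and> \<not> \<phi> False \<and> \<phi> True \<or> s = -1 \<and> \<phi> False \<and> \<not> \<phi> True)"
    (is "?l = ?r")
proof
  assume ?l
  then obtain x where "j \<in> V" and x: "x \<in> configs V" "\<not> x j"
    and s: "s = 1 \<and> \<not> f x v \<and> f (x(j := True)) v \<or> s = -1 \<and> f x v \<and> \<not> f (x(j := True)) v"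
    unfolding in_arcs_interaction_graph by blast
  have f': "f (x(j := True)) v = \<phi> ((x(j := True)) u)"
    using x(1) \<open>j \<in> V\<close> by (intro f[rule_format] configs_fun_upd)
  show ?r using s x(2) unfolding f' f[rule_format, OF x(1)] by (auto split: if_splits)
next
  assume r: ?r
  let ?x = "\<lambda>_. False"
  have "?x \<in> configs V" "?x(u := True) \<in> configs V"
    using u by (auto simp: configs_def)
  then show ?l using r u v unfolding in_arcs_interaction_graph by (auto simp: f intro!: bexI[of _ ?x])
qed

lemma in_arcs_binary:
  assumes v: "v \<in> V" and u: "u \<in> V" and w: "w \<in> V" and uw: "u \<noteq> w"
    and f: "\<forall>x \<in> configs V. f x v = \<phi> (x u) (x w)"
  shows "(j, s) \<in> in_arcs (interaction_graph V f) v \<longleftrightarrow>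
    j = u \<and> (\<exists>q. s = 1 \<and> \<not> \<phi> False q \<and> \<phi> True q \<or> s = -1 \<and> \<phi> False q \<and> \<not> \<phi> True q) \<or>
    j = w \<and> (\<exists>p. s = 1 \<and> \<not> \<phi> p False \<and> \<phi> p True \<or> s = -1 \<and> \<phi> p False \<and> \<not> \<phi> p True)"
    (is "?l = ?r")
proof
  assume ?l
  then obtain x where "j \<in> V" and x: "x \<in> configs V" "\<not> x j"
    and s: "s = 1 \<and> \<not> f x v \<and> f (x(j := True)) v \<or> s = -1 \<and> f x v \<and> \<not> f (x(j := True)) v"
    unfolding in_arcs_interaction_graph by blast
  have f': "f (x(j := True)) v = \<phi> ((x(j := True)) u) ((x(j := True)) w)"
    using x(1) \<open>j \<in> V\<close> by (intro f[rule_format] configs_fun_upd)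
  show ?r using s x(2) uw unfolding f' f[rule_format, OF x(1)] by (auto split: if_splits)
next
  assume r: ?r
  \<comment> \<open>These configurations realize every pair of inputs, so each rise or fall of
    \<open>\<phi>\<close> yields an arc.\<close>
  have c: "(\<lambda>_. False)(u := p, w := q) \<in> configs V" for p q
    using u w by (auto simp: configs_def)
  have fc: "f ((\<lambda>_. False)(u := p, w := q)) v = \<phi> p q" for p q
    using f[rule_format, OF c, of p q] uw by simp
  have flip: "((\<lambda>_. False)(u := False, w := q))(u := True) = (\<lambda>_. False)(u := True, w := q)"
    "((\<lambda>_. False)(u := p, w := False))(w := True) = (\<lambda>_. False)(u := p, w := True)" for p q
    using uw by (auto simp: fun_eq_iff)
  from r show ?l
  proof (elim disjE conjE exE, goal_cases)
    case (1 q) then show ?case unfolding in_arcs_interaction_graph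
      by (intro conjI bexI[OF _ c[of False q]]) (simp_all only: flip fc u v, simp_all add: uw)
  next
    case (2 q) then show ?case unfolding in_arcs_interaction_graph
      by (intro conjI bexI[OF _ c[of False q]]) (simp_all only: flip fc u v, simp_all add: uw)
  next
    case (3 p) then show ?case unfolding in_arcs_interaction_graph
      by (intro conjI bexI[OF _ c[of p False]]) (simp_all only: flip fc w v, simp_all add: uw)
  next
    case (4 p) then show ?case unfolding in_arcs_interaction_graph
      by (intro conjI bexI[OF _ c[of p False]]) (simp_all only: flip fc w v, simp_all add: uw)
  qed
qed

lemma in_arcs_unary_iff:
  assumes "finite V" and v: "v \<in> V" and u: "u \<in> V" and s: "s \<in> {1, -1}"
  shows "in_arcs (interaction_graph V f) v = {(u, s)} \<longleftrightarrow>
    (\<forall>x \<in> configs V. f x v = signed s (x u))" (is "?l = ?r")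
proof
  assume l: ?l
  define \<phi> where "\<phi> p = f ((\<lambda>_. False)(u := p)) v" for p
  have f: "\<forall>x \<in> configs V. f x v = \<phi> (x u)"
  proof
    fix x assume "x \<in> configs V"
    then show "f x v = \<phi> (x u)"
      unfolding \<phi>_def
      by - (rule local_function_cong[OF \<open>finite V\<close> _ _ v],
          use u l in \<open>auto simp: configs_def\<close>)
  qed
  have "(u, t) \<in> in_arcs (interaction_graph V f) v \<longleftrightarrow> t = s" for t
    using l by simp
  then have "t = s \<longleftrightarrow> (t = 1 \<and> \<not> \<phi> False \<and> \<phi> True \<or> t = -1 \<and> \<phi> False \<and> \<not> \<phi> True)" for t
    unfolding in_arcs_unary[where f=f and \<phi>=\<phi>, OF v u f] by auto
  from this[of s] have "\<phi> p = signed s p" for p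
    using s by (cases p) auto
  then show ?r using f by simp
next
  assume ?r
  then have f: "\<forall>x \<in> configs V. f x v = signed s (x u)" .
  show ?l
    unfolding set_eq_iff using in_arcs_unary[where f=f and \<phi>="signed s", OF v u f] s
    by (auto simp: signed_def)
qed

text \<open>Of the sixteen Boolean functions of two arguments, only the conjunction and the
  disjunction of the signed arguments have exactly one arc, of the prescribed sign, from each;
  exclusive or and its negation have arcs of both signs.\<close>

lemma in_arcs_binary_iff:
  assumes "finite V" and v: "v \<in> V" and u: "u \<in> V" and w: "w \<in> V" and uw: "u \<noteq> w"
    and s: "s \<in> {1, -1}" and t: "t \<in> {1, -1}"
  shows "in_arcs (interaction_graph V f) v = {(u, s), (w, t)} \<longleftrightarrow>
    (\<forall>x \<in> configs V. f x v = (signed s (x u) \<and> signed t (x w))) \<or>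
    (\<forall>x \<in> configs V. f x v = (signed s (x u) \<or> signed t (x w)))" (is "?l = ?r")
proof
  assume l: ?l
  define \<phi> where "\<phi> p q = f ((\<lambda>_. False)(u := p, w := q)) v" for p q
  have f: "\<forall>x \<in> configs V. f x v = \<phi> (x u) (x w)"
  proof
    fix x assume "x \<in> configs V"
    then show "f x v = \<phi> (x u) (x w)"
      unfolding \<phi>_def
      by - (rule local_function_cong[OF \<open>finite V\<close> _ _ v],
          use u w uw l in \<open>auto simp: configs_def\<close>)
  qed
  note arcs = in_arcs_binary[where f=f and \<phi>=\<phi>, OF v u w uw f]
  have "(u, k) \<in> in_arcs (interaction_graph V f) v \<longleftrightarrow> k = s"
    "(w, k) \<in> in_arcs (interaction_graph V f) v \<longleftrightarrow> k = t" for k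
    using l uw by auto
  then have k: "k = s \<longleftrightarrow> (\<exists>q. k = 1 \<and> \<not> \<phi> False q \<and> \<phi> True q \<or> k = -1 \<and> \<phi> False q \<and> \<not> \<phi> True q)"
    "k = t \<longleftrightarrow> (\<exists>p. k = 1 \<and> \<not> \<phi> p False \<and> \<phi> p True \<or> k = -1 \<and> \<phi> p False \<and> \<not> \<phi> p True)" for k
    unfolding arcs using uw by simp_all
  have "(\<forall>p q. \<phi> p q = (signed s p \<and> signed t q)) \<or> (\<forall>p q. \<phi> p q = (signed s p \<or> signed t q))"
    using s t k(1)[of 1] k(1)[of "-1"] k(2)[of 1] k(2)[of "-1"] unfolding all_bool_eq ex_bool_eq
    by (cases "\<phi> False False"; cases "\<phi> False True"; cases "\<phi> True False"; cases "\<phi> True True") force+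
  then show ?r using f by auto
next
  assume ?r
  then show ?l
  proof
    assume f: "\<forall>x \<in> configs V. f x v = (signed s (x u) \<and> signed t (x w))"
    show ?l
      unfolding set_eq_iff
      using in_arcs_binary[where f=f and \<phi>="\<lambda>p q. signed s p \<and> signed t q", OF v u w uw f] s t
      by (force simp: signed_def ex_bool_eq)
  next
    assume f: "\<forall>x \<in> configs V. f x v = (signed s (x u) \<or> signed t (x w))"
    show ?l
      unfolding set_eq_iff
      using in_arcs_binary[where f=f and \<phi>="\<lambda>p q. signed s p \<or> signed t q", OF v u w uw f] s t
      by (force simp: signed_def ex_bool_eq)
  qed
qed

section \<open>Words\<close>

lemma upd_word_append: "upd_word f (u @ w) x = upd_word f w (upd_word f u x)"
  by (induction u arbitrary: x) auto

lemma upd_configs: "x \<in> configs V \<Longrightarrow> i \<in> V \<Longrightarrow> upd f i x \<in> configs V"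
  by (simp add: upd_def configs_fun_upd)

lemma upd_word_configs: "x \<in> configs V \<Longrightarrow> set w \<subseteq> V \<Longrightarrow> upd_word f w x \<in> configs V"
  by (induction w arbitrary: x) (auto simp: upd_configs)

lemma upd_word_outside: "v \<notin> set w \<Longrightarrow> upd_word f w x v = x v"
  by (induction w arbitrary: x) (auto simp: upd_def)

lemma upd_word_stable:
  assumes "\<And>i. i \<in> set w \<Longrightarrow> f x i = x i"
  shows "upd_word f w x = x"
  using assms by (induction w) (auto simp: upd_def)

text \<open>Without repetition the first letter is never rewritten, so its update already leaves
  \<open>x\<close> unchanged; induction handles the rest.\<close>

lemma upd_word_stableD:
  assumes "distinct w" and "upd_word f w x = x" and "i \<in> set w"
  shows "f x i = x i"
  using assms
proof (induction w)
  case (Cons j w)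
  have "f x j = upd_word f w (upd f j x) j"
    using Cons.prems(1) by (simp add: upd_word_outside upd_def)
  then have j: "f x j = x j" using Cons.prems(2) by simp
  then have "upd f j x = x" by (simp add: upd_def)
  with j Cons show ?case by auto
qed simp

lemma synchronizing_unique_fixed_point:
  assumes "synchronizing V f" and "fixed_point V f x" and "fixed_point V f y"
  shows "x = y"
proof -
  obtain w c where w: "set w \<subseteq> V" "\<forall>x \<in> configs V. upd_word f w x = c"
    using assms(1) unfolding synchronizing_def synchronizes_def by blast
  have "upd_word f w x = x" "upd_word f w y = y"
    using assms w(1) by (auto simp: fixed_point_def intro!: upd_word_stable)
  then show ?thesis using w(2) assms by (auto simp: fixed_point_def)
qed

text \<open>Topological order relative to \<open>A\<close>: each update reads only vertices of
  \<open>A\<close> or vertices updated earlier, so initial values outside \<open>A\<close> have no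
  influence on the updated vertices.\<close>

fun determines :: "'v sdigraph \<Rightarrow> 'v set \<Rightarrow> 'v list \<Rightarrow> bool" where
  "determines G A [] \<longleftrightarrow> True"
| "determines G A (i # w) \<longleftrightarrow> fst ` in_arcs G i \<subseteq> A \<and> determines G (insert i A) w"

lemma determines_append:
  "determines G A (u @ w) \<longleftrightarrow> determines G A u \<and> determines G (A \<union> set u) w"
  by (induction u arbitrary: A) auto

lemma upd_word_agree:
  assumes "finite V" and "set w \<subseteq> V" and "determines (interaction_graph V f) A w"
    and "x \<in> configs V" and "y \<in> configs V" and "\<forall>v \<in> A. x v = y v" and "v \<in> A \<union> set w"
  shows "upd_word f w x v = upd_word f w y v"
  using assms(2-)
proof (induction w arbitrary: A x y)
  case (Cons i w)
  have i: "i \<in> V" "fst ` in_arcs (interaction_graph V f) i \<subseteq> A"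
    and w: "set w \<subseteq> V" "determines (interaction_graph V f) (insert i A) w"
    using Cons.prems by auto
  have "f x i = f y i"
  proof (rule local_function_cong[OF \<open>finite V\<close> Cons.prems(3,4) i(1)])
    fix j s assume "(j, s) \<in> in_arcs (interaction_graph V f) i"
    then have "j \<in> A" using i(2) by force
    then show "x j = y j" using Cons.prems(5) by blast
  qed
  then have "\<forall>v \<in> insert i A. upd f i x v = upd f i y v"
    using Cons.prems(5) by (auto simp: upd_def)
  moreover have "v \<in> insert i A \<union> set w" using Cons.prems(6) by auto
  ultimately show ?case
    using Cons.IH[OF w upd_configs[OF Cons.prems(3) i(1)] upd_configs[OF Cons.prems(4) i(1)]]
    by simp
qed auto

section \<open>The gates of the networks on $G_\psi$\<close>

lemma lit_vtx_inject [simp]: "lit_vtx l = lit_vtx l' \<longleftrightarrow> l = l'"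
  by (auto simp: lit_vtx_def prod_eq_iff)

lemma lit_vtx_distinct [simp]:
  "lit_vtx l \<noteq> Ell r" "lit_vtx l \<noteq> MuP s" "lit_vtx l \<noteq> Mu s" "lit_vtx l \<noteq> Cv s"
  "lit_vtx l \<noteq> Qv" "lit_vtx l \<noteq> Tv"
  "MuP s \<noteq> lit_vtx l"
  by (simp_all add: lit_vtx_def)

lemma finite_V_G: "finite (V_G n m)"
proof -
  have "{Lit r b | r b. r \<in> {1..n}} = (\<lambda>(r, b). Lit r b) ` ({1..n} \<times> UNIV)" by auto
  then show ?thesis by (simp add: V_G_def)
qed

lemma mem_V_G [simp]:
  "Lit r b \<in> V_G n m \<longleftrightarrow> 1 \<le> r \<and> r \<le> n"
  "Ell r \<in> V_G n m \<longleftrightarrow> r \<le> n"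
  "MuP s \<in> V_G n m \<longleftrightarrow> 1 \<le> s \<and> s \<le> m"
  "Mu s \<in> V_G n m \<longleftrightarrow> 1 \<le> s \<and> s \<le> m"
  "Cv s \<in> V_G n m \<longleftrightarrow> 1 \<le> s \<and> s \<le> m"
  "Qv \<in> V_G n m" "Tv \<in> V_G n m"
  by (auto simp: V_G_def)

lemma Ball_V_G:
  "(\<forall>v \<in> V_G n m. P v) \<longleftrightarrow>
    (\<forall>r \<in> {1..n}. \<forall>b. P (Lit r b)) \<and> P (Ell 0) \<and> (\<forall>r \<in> {1..n}. P (Ell r)) \<and>
    (\<forall>s \<in> {1..m}. P (MuP s) \<and> P (Mu s) \<and> P (Cv s)) \<and> P Qv \<and> P Tv" (is "?l = ?r")
proof
  assume ?l then show ?r by simp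
next
  assume r: ?r
  show ?l
  proof
    fix v assume v: "v \<in> V_G n m"
    show "P v"
    proof (cases v)
      case (Ell k)
      then show ?thesis using v r by (cases "k = 0") auto
    qed (use v r in auto)
  qed
qed

text \<open>The disjunction stands outside the quantifiers over configurations: a network fixes the
  kind of gate at a vertex once and for all.\<close>

definition gate :: "'v set \<Rightarrow> (('v \<Rightarrow> bool) \<Rightarrow> 'v \<Rightarrow> bool) \<Rightarrow> 'v \<Rightarrow> 'v \<times> int \<Rightarrow> 'v \<times> int \<Rightarrow> bool" where
  "gate V f v a b \<longleftrightarrow>
    (\<forall>x \<in> configs V. f x v = (signed (snd a) (x (fst a)) \<and> signed (snd b) (x (fst b)))) \<or>
    (\<forall>x \<in> configs V. f x v = (signed (snd a) (x (fst a)) \<or> signed (snd b) (x (fst b))))"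

lemma gateE:
  assumes "gate V f v (u, s) (w, t)"
  obtains "\<And>x. x \<in> configs V \<Longrightarrow> f x v = (signed s (x u) \<and> signed t (x w))"
  | "\<And>x. x \<in> configs V \<Longrightarrow> f x v = (signed s (x u) \<or> signed t (x w))"
  using assms unfolding gate_def by fastforce

text \<open>For comparing two fixed points: the same kind of gate acts on both.\<close>

lemma gate_two_configs:
  assumes "gate V f v (u, s) (w, t)" and "x \<in> configs V" and "y \<in> configs V"
  shows "f x v = (signed s (x u) \<and> signed t (x w)) \<and> f y v = (signed s (y u) \<and> signed t (y w)) \<or>
    f x v = (signed s (x u) \<or> signed t (x w)) \<and> f y v = (signed s (y u) \<or> signed t (y w))"
  by (rule gateE[OF assms(1)]) (simp_all add: assms(2,3))

locale formula =
  fixes n m :: nat and cl :: "nat \<Rightarrow> nat \<Rightarrow> nat \<times> bool"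
  assumes n_pos: "n \<ge> 1" and m_pos: "m \<ge> 1" and wf: "wf_3cnf n m cl"
begin

abbreviation "V \<equiv> V_G n m"
abbreviation "G \<equiv> G_psi n m cl"

lemma clause_lit: "s \<in> {1..m} \<Longrightarrow> k \<in> {1..3} \<Longrightarrow> lit_vtx (cl s k) \<in> V"
  using wf by (auto simp: wf_3cnf_def lit_vtx_def)

lemma clause_lits_distinct: "s \<in> {1..m} \<Longrightarrow> cl s 1 \<noteq> cl s 2"
  using wf by (force simp: wf_3cnf_def inj_on_def)

lemma cv_mem: "s \<in> {1..m} \<Longrightarrow> cv n m (Suc s) \<in> V"
  by (auto simp: cv_def)

lemma cv_neq_Mu: "cv n m k \<noteq> Mu s" "Mu s \<noteq> cv n m k"
  by (auto simp: cv_def)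

lemma in_arcs_G:
  "r \<in> {1..n} \<Longrightarrow> in_arcs G (Lit r b) = {(Ell (r - 1), 1), (Tv, 1)}"
  "in_arcs G (Ell 0) = {(Cv 1, 1)}"
  "r \<in> {1..n} \<Longrightarrow> in_arcs G (Ell r) = {(Lit r True, 1), (Lit r False, 1)}"
  "s \<in> {1..m} \<Longrightarrow> in_arcs G (MuP s) = {(lit_vtx (cl s 1), 1), (lit_vtx (cl s 2), 1)}"
  "s \<in> {1..m} \<Longrightarrow> in_arcs G (Mu s) = {(MuP s, 1), (lit_vtx (cl s 3), 1)}"
  "s \<in> {1..m} \<Longrightarrow> in_arcs G (Cv s) = {(Mu s, -1), (cv n m (Suc s), 1)}"
  "in_arcs G Qv = {(Ell 0, -1)}"
  "in_arcs G Tv = {(Ell 0, 1), (Qv, 1)}"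
  by (auto simp: in_arcs_def G_psi_def H_psi_def)

lemma in_arcs_G_outside:
  assumes "v \<notin> V"
  shows "in_arcs G v = {}"
  using assms by (cases v) (auto simp: in_arcs_def G_psi_def H_psi_def)

text \<open>A single in-arc forces the local function, while two in-neighbours leave a choice
  between conjunction and disjunction.\<close>

lemma BN_on_iff:
  "BN_on V G f \<longleftrightarrow>
    (\<forall>r \<in> {1..n}. \<forall>b. gate V f (Lit r b) (Ell (r - 1), 1) (Tv, 1)) \<and>
    (\<forall>x \<in> configs V. f x (Ell 0) = x (Cv 1)) \<and>
    (\<forall>r \<in> {1..n}. gate V f (Ell r) (Lit r True, 1) (Lit r False, 1)) \<and>
    (\<forall>s \<in> {1..m}. gate V f (MuP s) (lit_vtx (cl s 1), 1) (lit_vtx (cl s 2), 1) \<and>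
      gate V f (Mu s) (MuP s, 1) (lit_vtx (cl s 3), 1) \<and>
      gate V f (Cv s) (Mu s, -1) (cv n m (Suc s), 1)) \<and>
    (\<forall>x \<in> configs V. f x Qv = (\<not> x (Ell 0))) \<and>
    gate V f Tv (Ell 0, 1) (Qv, 1)"
proof -
  let ?I = "in_arcs (interaction_graph V f)"
  have "?I v = in_arcs G v" if "v \<notin> V" for v
    using that by (auto simp: in_arcs_G_outside in_arcs_interaction_graph)
  then have BN: "BN_on V G f \<longleftrightarrow> (\<forall>v \<in> V. ?I v = in_arcs G v)"
    unfolding BN_on_def sdigraph_eq_iff by blast
  have gate: "?I v = {(u, s), (w, t)} \<longleftrightarrow> gate V f v (u, s) (w, t)"
    if "v \<in> V" "u \<in> V" "w \<in> V" "u \<noteq> w" "s \<in> {1, -1}" "t \<in> {1, -1}" for v u w s t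
    unfolding gate_def using in_arcs_binary_iff[OF finite_V_G that] by simp
  have unary: "?I v = {(u, s)} \<longleftrightarrow> (\<forall>x \<in> configs V. f x v = signed s (x u))"
    if "v \<in> V" "u \<in> V" "s \<in> {1, -1}" for v u s
    using in_arcs_unary_iff[OF finite_V_G that] .
  have "?I (Lit r b) = in_arcs G (Lit r b) \<longleftrightarrow> gate V f (Lit r b) (Ell (r - 1), 1) (Tv, 1)"
    if "r \<in> {1..n}" for r b
    unfolding in_arcs_G(1)[OF that] by (rule gate) (use that in auto)
  moreover have "?I (Ell 0) = in_arcs G (Ell 0) \<longleftrightarrow> (\<forall>x \<in> configs V. f x (Ell 0) = x (Cv 1))"
    unfolding in_arcs_G(2) by (subst unary) (use m_pos in auto)
  moreover have "?I (Ell r) = in_arcs G (Ell r) \<longleftrightarrow> gate V f (Ell r) (Lit r True, 1) (Lit r False, 1)"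
    if "r \<in> {1..n}" for r
    unfolding in_arcs_G(3)[OF that] by (rule gate) (use that in auto)
  moreover have "?I (MuP s) = in_arcs G (MuP s) \<longleftrightarrow>
      gate V f (MuP s) (lit_vtx (cl s 1), 1) (lit_vtx (cl s 2), 1)" if "s \<in> {1..m}" for s
    unfolding in_arcs_G(4)[OF that]
    \<comment> \<open>Distinctness of the first two literals gives \<open>MuP s\<close> two
      different in-neighbours.\<close>
    by (rule gate) (use that clause_lit clause_lits_distinct in auto)
  moreover have "?I (Mu s) = in_arcs G (Mu s) \<longleftrightarrow> gate V f (Mu s) (MuP s, 1) (lit_vtx (cl s 3), 1)"
    if "s \<in> {1..m}" for s
    unfolding in_arcs_G(5)[OF that] by (rule gate) (use that clause_lit in auto)
  moreover have "?I (Cv s) = in_arcs G (Cv s) \<longleftrightarrow> gate V f (Cv s) (Mu s, -1) (cv n m (Suc s), 1)"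
    if "s \<in> {1..m}" for s
    unfolding in_arcs_G(6)[OF that] by (rule gate) (use that cv_mem cv_neq_Mu in auto)
  moreover have "?I Qv = in_arcs G Qv \<longleftrightarrow> (\<forall>x \<in> configs V. f x Qv = (\<not> x (Ell 0)))"
    unfolding in_arcs_G(7) by (subst unary) auto
  moreover have "?I Tv = in_arcs G Tv \<longleftrightarrow> gate V f Tv (Ell 0, 1) (Qv, 1)"
    unfolding in_arcs_G(8) by (rule gate) auto
  ultimately show ?thesis
    unfolding BN Ball_V_G by (simp only: cong: ball_cong)
qed

lemma configs_eqI:
  assumes "x \<in> configs V" and "y \<in> configs V" and "\<And>v. v \<in> V \<Longrightarrow> x v = y v"
  shows "x = y"
  using assms by (auto simp: configs_def fun_eq_iff)

lemma satisfiable_iff: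
  "satisfiable m cl \<longleftrightarrow> (\<exists>z. \<forall>s \<in> {1..m}. z (fst (cl s 1)) = snd (cl s 1) \<or>
    z (fst (cl s 2)) = snd (cl s 2) \<or> z (fst (cl s 3)) = snd (cl s 3))"
proof -
  have "{1..3} = {1, 2, 3 :: nat}" by auto
  then show ?thesis unfolding satisfiable_def by simp
qed

section \<open>Words that sweep through $G_\psi$\<close>

definition block :: "nat \<Rightarrow> vtx list" where
  "block r = [Lit r True, Lit r False, Ell r]"

definition chain :: "nat \<Rightarrow> nat \<Rightarrow> vtx list" where
  "chain i j = concat (map block [i..<Suc j])"

text \<open>\<open>Cv s\<close> reads \<open>Cv (s + 1)\<close> and \<open>Cv m\<close> reads
  \<open>Ell n\<close>, hence the decreasing order.\<close>

definition clause_word :: "vtx list" where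
  "clause_word = concat (map (\<lambda>s. [MuP s, Mu s]) [1..<Suc m]) @ map Cv (rev [1..<Suc m])"

definition sweep :: "vtx list" where
  "sweep = chain 1 n @ clause_word"

lemma set_chain: "set (chain i j) = {Lit r b | r b. r \<in> {i..j}} \<union> Ell ` {i..j}"
  by (force simp: chain_def block_def)

lemma set_clause_word: "set clause_word = MuP ` {1..m} \<union> Mu ` {1..m} \<union> Cv ` {1..m}"
  by (force simp: clause_word_def)

lemma set_sweep: "set sweep = V - {Ell 0, Qv, Tv}"
  by (auto simp: sweep_def set_chain set_clause_word V_G_def image_iff)

lemma length_concat_const:
  "(\<And>x. x \<in> set xs \<Longrightarrow> length (g x) = k) \<Longrightarrow> length (concat (map g xs)) = length xs * k"
  by (induction xs) auto

lemma length_chain: "i \<le> Suc j \<Longrightarrow> length (chain i j) = 3 * (Suc j - i)"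
  unfolding chain_def by (subst length_concat_const[of _ _ 3]) (auto simp: block_def)

lemma length_clause_word: "length clause_word = 3 * m"
  unfolding clause_word_def by (simp, subst length_concat_const[of _ _ 2]) auto

lemma length_sweep: "length sweep = 3 * n + 3 * m"
  by (simp add: sweep_def length_chain length_clause_word)

lemma sweep_split: "sweep = block 1 @ chain 2 n @ clause_word"
  using n_pos by (simp add: sweep_def chain_def upt_conv_Cons numeral_2_eq_2 del: upt_Suc)

lemma distinct_sweep: "distinct sweep"
proof -
  have "distinct (chain i j)" for i j
    unfolding chain_def
    by (rule distinct_concat) (auto simp: distinct_map inj_on_def block_def)
  moreover have "distinct clause_word"
    unfolding clause_word_def
    by (auto simp: distinct_map inj_on_def intro!: distinct_concat)
  ultimately show ?thesis
    by (auto simp: sweep_def set_chain set_clause_word)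
qed

lemma determines_chain:
  assumes "Tv \<in> A" and "Ell (i - 1) \<in> A" and "1 \<le> i" and "i \<le> Suc j" and "j \<le> n"
  shows "determines G A (chain i j)"
  using assms(4,5)
proof (induction j)
  case 0
  \<comment> \<open>The bounds leave only the empty chain.\<close>
  then have "i = 1" using assms(3) by simp
  then show ?case by (simp add: chain_def)
next
  case (Suc j)
  show ?case
  proof (cases "i = Suc (Suc j)")
    case True
    then show ?thesis by (simp add: chain_def)
  next
    case False
    then have split: "chain i (Suc j) = chain i j @ block (Suc j)"
      using Suc.prems by (simp add: chain_def)
    have "Ell j \<in> A \<union> set (chain i j)"
      using False Suc.prems assms(2) by (cases "i = Suc j") (auto simp: set_chain)
    then show ?thesis
      using Suc False assms(1) in_arcs_G(1)[of "Suc j"] in_arcs_G(3)[of "Suc j"]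
      unfolding split by (auto simp: determines_append block_def)
  qed
qed

lemma determines_clause_word:
  assumes lits: "\<And>r b. r \<in> {1..n} \<Longrightarrow> Lit r b \<in> A" and ell: "Ell n \<in> A"
  shows "determines G A clause_word"
proof -
  have lit: "lit_vtx (cl s k) \<in> A" if "s \<in> {1..m}" "k \<in> {1..3}" for s k
    using wf lits that by (auto simp: wf_3cnf_def lit_vtx_def)
  have mus: "determines G A (concat (map (\<lambda>s. [MuP s, Mu s]) [1..<Suc j]))" if "j \<le> m" for j
    using that
  proof (induction j)
    case (Suc j)
    then show ?case
      using in_arcs_G(4)[of "Suc j"] in_arcs_G(5)[of "Suc j"] lit[of "Suc j"]
      by (auto simp: determines_append)
  qed simp
  have cvs: "determines G B (map Cv (rev [1..<Suc j]))"
    if "j \<le> m" "cv n m (Suc j) \<in> B" "Mu ` {1..m} \<subseteq> B" for j B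
    using that
  proof (induction j arbitrary: B)
    case (Suc j)
    then have "determines G (insert (Cv (Suc j)) B) (map Cv (rev [1..<Suc j]))"
      by (intro Suc.IH) (auto simp: cv_def)
    then show ?case
      using Suc.prems in_arcs_G(6)[of "Suc j"] by auto
  qed simp
  show ?thesis
    unfolding clause_word_def determines_append
    by (intro conjI mus cvs) (auto simp: cv_def ell)
qed

lemma determines_sweep: "Ell 0 \<in> A \<Longrightarrow> Tv \<in> A \<Longrightarrow> determines G A sweep"
  unfolding sweep_def determines_append using n_pos
  by (intro conjI determines_chain determines_clause_word) (auto simp: set_chain)

definition settle :: "vtx list" where
  "settle = Qv # Tv # sweep"

text \<open>\<open>Tv\<close> is left out: after \<open>settle\<close> its value no longer depends
  on \<open>Ell 0\<close>.\<close>

definition turn :: "vtx list" where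
  "turn = Ell 0 # Qv # sweep"

text \<open>
  The vertex $q$ is not updated: when $t$ is updated, $q$ is one flip of $\ell_0$ behind.
\<close>

definition skew :: "vtx list" where
  "skew = Ell 0 # sweep @ [Tv, Ell 0]"

text \<open>
  The vertex $t$ returns to its constant value only after $\ell_1$ has been updated from
  $\lambda_1^\pm$.
\<close>

definition collapse :: "vtx list" where
  "collapse = block 1 @ [Qv, Tv] @ chain 2 n @ clause_word @ [Ell 0, Qv]"

text \<open>Each of the four pieces contains the \<open>3 * n + 3 * m\<close> letters of a sweep,
  with 2, 2, 3 and 4 further letters. The first two pieces suffice when the return map of
  \<open>Ell 0\<close> is constant; the last two treat negation.\<close>

definition sync_word :: "vtx list" where
  "sync_word = settle @ turn @ skew @ collapse"

lemma set_settle: "set settle = V - {Ell 0}"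
  by (auto simp: settle_def set_sweep)

lemma determines_settle: "determines G {Ell 0} settle"
  using in_arcs_G(7,8) by (auto simp: settle_def determines_sweep)

lemma set_sync_word: "set sync_word \<subseteq> V"
  using n_pos
  by (auto simp: sync_word_def set_settle turn_def skew_def collapse_def block_def set_sweep
      set_chain set_clause_word)

lemma length_sync_word: "length sync_word = 12 * n + 12 * m + 11"
  using n_pos
  by (simp add: sync_word_def settle_def turn_def skew_def collapse_def block_def length_sweep
      length_chain length_clause_word)

end

section \<open>Synchronization\<close>

locale network = formula +
  fixes f :: "(vtx \<Rightarrow> bool) \<Rightarrow> vtx \<Rightarrow> bool"
  assumes BN: "BN_on V G f"
begin

lemma gates:
  "r \<in> {1..n} \<Longrightarrow> gate V f (Lit r b) (Ell (r - 1), 1) (Tv, 1)"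
  "r \<in> {1..n} \<Longrightarrow> gate V f (Ell r) (Lit r True, 1) (Lit r False, 1)"
  "s \<in> {1..m} \<Longrightarrow> gate V f (MuP s) (lit_vtx (cl s 1), 1) (lit_vtx (cl s 2), 1)"
  "s \<in> {1..m} \<Longrightarrow> gate V f (Mu s) (MuP s, 1) (lit_vtx (cl s 3), 1)"
  "s \<in> {1..m} \<Longrightarrow> gate V f (Cv s) (Mu s, -1) (cv n m (Suc s), 1)"
  "gate V f Tv (Ell 0, 1) (Qv, 1)"
  using BN unfolding BN_on_iff by simp_all

lemma f_Ell_0: "x \<in> configs V \<Longrightarrow> f x (Ell 0) = x (Cv 1)"
  and f_Qv: "x \<in> configs V \<Longrightarrow> f x Qv = (\<not> x (Ell 0))"
  using BN unfolding BN_on_iff by simp_all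

text \<open>Here \<open>Ell 0\<close> is False and \<open>Qv\<close> True, so \<open>\<tau>\<close>
  records the kind of gate at \<open>Tv\<close>: True for a disjunction, False for a
  conjunction.\<close>

definition \<tau> :: bool where
  "\<tau> = f ((\<lambda>_. False)(Qv := True)) Tv"

text \<open>On opposite inputs a disjunction is True and a conjunction False, whichever input is the
  True one.\<close>

lemma f_Tv_const:
  assumes "x \<in> configs V" and "x Qv \<longleftrightarrow> \<not> x (Ell 0)"
  shows "f x Tv = \<tau>"
proof -
  have "(\<lambda>_. False)(Qv := True) \<in> configs V" by (simp add: configs_def V_G_def)
  with gates(6) assms show ?thesis
    unfolding \<tau>_def by (elim gateE) auto
qed

text \<open>On equal inputs both kinds of gate return the common value.\<close>

lemma f_Tv_copy:
  assumes "x \<in> configs V" and "x Qv \<longleftrightarrow> x (Ell 0)"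
  shows "f x Tv = x (Ell 0)"
  using gates(6) assms by (elim gateE) auto

lemma f_Lit_1_const:
  assumes "x \<in> configs V" and "x Tv \<longleftrightarrow> \<not> x (Ell 0)"
    and "y \<in> configs V" and "y Tv \<longleftrightarrow> \<not> y (Ell 0)"
  shows "f x (Lit 1 b) = f y (Lit 1 b)"
proof -
  have "gate V f (Lit 1 b) (Ell (1 - 1), 1) (Tv, 1)" using n_pos by (intro gates) simp
  then show ?thesis using assms by (elim gateE) auto
qed

lemma agree:
  assumes "set w \<subseteq> V" and "determines G A w"
    and "x \<in> configs V" and "y \<in> configs V" and "\<forall>v \<in> A. x v = y v"
  shows "\<forall>v \<in> A \<union> set w. upd_word f w x v = upd_word f w y v"
proof -
  have "determines (interaction_graph V f) A w"
    using assms(2) BN by (simp only: BN_on_def)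
  from upd_word_agree[OF finite_V_G assms(1) this assms(3-5)] show ?thesis by blast
qed

lemma agree_all:
  assumes "set w \<subseteq> V" and "determines G A w"
    and "x \<in> configs V" and "y \<in> configs V" and "\<forall>v \<in> A. x v = y v" and "V \<subseteq> A \<union> set w"
  shows "upd_word f w x = upd_word f w y"
  by (rule configs_eqI[OF upd_word_configs[OF assms(3,1)] upd_word_configs[OF assms(4,1)]])
    (use agree[OF assms(1-5)] assms(6) in blast)

text \<open>The False values in the start are arbitrary: \<open>settle\<close> overwrites every
  vertex but \<open>Ell 0\<close> without reading old values.\<close>

definition F :: "bool \<Rightarrow> vtx \<Rightarrow> bool" where
  "F a = upd_word f settle (\<lambda>v. v = Ell 0 \<and> a)"

lemma F_configs: "F a \<in> configs V"
  unfolding F_def by (rule upd_word_configs) (auto simp: configs_def set_settle)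

lemma F_Ell_0: "F a (Ell 0) = a"
  unfolding F_def by (subst upd_word_outside) (auto simp: set_settle)

lemma upd_word_settle:
  assumes "x \<in> configs V"
  shows "upd_word f settle x = F (x (Ell 0))"
  unfolding F_def
  by (rule agree_all[OF _ determines_settle assms]) (auto simp: set_settle configs_def)

text \<open>\<open>settle\<close> leaves \<open>F a\<close> unchanged and updates no vertex twice,
  so each of its updates is idle there.\<close>

lemma F_stable: "v \<in> V \<Longrightarrow> v \<noteq> Ell 0 \<Longrightarrow> f (F a) v = F a v"
proof (rule upd_word_stableD[of settle])
  show "distinct settle" by (simp add: settle_def distinct_sweep set_sweep)
  show "upd_word f settle (F a) = F a"
    by (simp add: upd_word_settle F_configs F_Ell_0)
qed (simp add: set_settle)

lemma F_Qv: "F a Qv \<longleftrightarrow> \<not> a"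
  using F_stable[of Qv a] by (simp add: f_Qv F_configs F_Ell_0)

lemma F_Tv: "F a Tv = \<tau>"
  using F_stable[of Tv a] f_Tv_const[of "F a"] by (simp add: F_Qv F_configs F_Ell_0)

text \<open>The sweep neither reads nor updates \<open>Qv\<close>; everything it computes is
  determined by \<open>Ell 0\<close> and \<open>Tv\<close>.\<close>

lemma upd_word_sweep:
  assumes x: "x \<in> configs V" and t: "x Tv = \<tau>"
  shows "upd_word f sweep x = (F (x (Ell 0)))(Qv := x Qv)"
proof -
  let ?y = "F (x (Ell 0))"
  have y: "upd_word f sweep ?y = ?y"
    by (rule upd_word_stable) (simp add: F_stable set_sweep)
  have "\<forall>v \<in> {Ell 0, Tv} \<union> set sweep. upd_word f sweep x v = upd_word f sweep ?y v"
  proof (rule agree[OF _ determines_sweep x F_configs])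
    show "\<forall>v \<in> {Ell 0, Tv}. x v = ?y v" by (simp add: F_Ell_0 F_Tv t)
  qed (simp_all add: set_sweep)
  then have eq: "upd_word f sweep x v = ?y v" if "v \<in> V" "v \<noteq> Qv" for v
    using that by (simp only: y set_sweep) blast
  have q: "upd_word f sweep x Qv = x Qv"
    by (rule upd_word_outside) (simp add: set_sweep)
  show ?thesis
  proof (rule configs_eqI)
    show "upd_word f sweep x v = (?y(Qv := x Qv)) v" if "v \<in> V" for v
      using eq q that by (cases "v = Qv") simp_all
    show "upd_word f sweep x \<in> configs V"
      by (rule upd_word_configs[OF x]) (simp add: set_sweep)
    show "?y(Qv := x Qv) \<in> configs V"
      by (rule configs_fun_upd[OF F_configs]) simp
  qed
qed

definition h :: "bool \<Rightarrow> bool" where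
  "h a = F a (Cv 1)"

lemma fixed_point_F: "h a = a \<Longrightarrow> fixed_point V f (F a)"
  unfolding fixed_point_def
  using F_configs F_stable f_Ell_0[OF F_configs] F_Ell_0 by (metis h_def)

lemma upd_word_turn: "upd_word f turn (F a) = F (h a)"
proof -
  let ?x = "(F a)(Ell 0 := h a, Qv := \<not> h a)"
  have "(F a)(Ell 0 := h a) \<in> configs V" by (simp add: F_configs configs_fun_upd)
  then have "upd_word f turn (F a) = upd_word f sweep ?x"
    by (simp add: turn_def upd_def f_Ell_0 f_Qv F_configs h_def)
  also have "\<dots> = (F (h a))(Qv := \<not> h a)"
    by (subst upd_word_sweep) (simp_all add: F_configs configs_fun_upd F_Tv)
  also have "\<dots> = F (h a)"
    using F_Qv[of "h a"] by (simp add: fun_upd_idem)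
  finally show ?thesis .
qed

text \<open>When \<open>Ell 0\<close> flips to \<open>\<not> a\<close>, \<open>Qv\<close> already
  has that value, so \<open>Tv\<close> sees equal inputs and copies them. The sweep sets
  \<open>Cv 1\<close> to \<open>h (\<not> a)\<close>, hence the last update returns
  \<open>Ell 0\<close> to \<open>a\<close>, opposite to \<open>Tv\<close>.\<close>

lemma upd_word_skew:
  assumes "h a \<longleftrightarrow> \<not> a" and "h (\<not> a) \<longleftrightarrow> a"
  shows "upd_word f skew (F a) = (F (\<not> a))(Qv := \<not> a, Tv := \<not> a, Ell 0 := a)"
proof -
  have "upd f (Ell 0) (F a) = (F a)(Ell 0 := \<not> a)"
    using assms(1) by (simp add: upd_def f_Ell_0 F_configs h_def)
  moreover have "upd_word f sweep ((F a)(Ell 0 := \<not> a)) = (F (\<not> a))(Qv := \<not> a)"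
    by (subst upd_word_sweep) (simp_all add: F_configs configs_fun_upd F_Tv F_Qv)
  moreover have "upd f Tv ((F (\<not> a))(Qv := \<not> a)) = (F (\<not> a))(Qv := \<not> a, Tv := \<not> a)"
    unfolding upd_def
    by (subst f_Tv_copy) (simp_all add: F_configs configs_fun_upd F_Ell_0)
  moreover have "upd f (Ell 0) ((F (\<not> a))(Qv := \<not> a, Tv := \<not> a)) =
      (F (\<not> a))(Qv := \<not> a, Tv := \<not> a, Ell 0 := a)"
    unfolding upd_def
    by (subst f_Ell_0) (use assms(2) in \<open>simp_all add: F_configs configs_fun_upd h_def\<close>)
  ultimately show ?thesis
    by (simp add: skew_def upd_word_append)
qed

lemma upd_word_collapse:
  assumes x: "x \<in> configs V" "x Tv \<longleftrightarrow> \<not> x (Ell 0)"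
    and y: "y \<in> configs V" "y Tv \<longleftrightarrow> \<not> y (Ell 0)"
  shows "upd_word f collapse x = upd_word f collapse y"
proof -
  let ?A = "{Lit 1 True, Lit 1 False}"
  let ?u = "[Lit 1 True, Lit 1 False]" and ?v = "[Ell 1, Qv, Tv]"
    and ?w = "chain 2 n @ clause_word @ [Ell 0, Qv]"
  have V: "set ?u \<subseteq> V" "set ?v \<subseteq> V" "set ?w \<subseteq> V" "Lit 1 True \<in> V" "Lit 1 False \<in> V" "Ell 1 \<in> V"
    using n_pos by (auto simp: set_chain set_clause_word)
  have u: "upd_word f ?u z = z(Lit 1 True := f x (Lit 1 True), Lit 1 False := f x (Lit 1 False))"
    if z: "z \<in> configs V" "z Tv \<longleftrightarrow> \<not> z (Ell 0)" for z
  proof -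
    let ?z = "z(Lit 1 True := f x (Lit 1 True))"
    have "f z (Lit 1 True) = f x (Lit 1 True)" by (rule f_Lit_1_const) (use z x in auto)
    \<comment> \<open>Updating \<open>Lit 1 True\<close> changes neither \<open>Ell 0\<close> nor
      \<open>Tv\<close>, so the inputs of \<open>Lit 1 False\<close> are still opposite.\<close>
    moreover have "f ?z (Lit 1 False) = f x (Lit 1 False)"
      by (rule f_Lit_1_const) (use z x V in \<open>auto simp: configs_fun_upd\<close>)
    ultimately show ?thesis by (simp add: upd_def)
  qed
  \<comment> \<open>\<open>Qv\<close> is refreshed first, so \<open>Tv\<close> sees opposite
    inputs.\<close>
  have Tv: "upd_word f ?v z Tv = \<tau>" if "z \<in> configs V" for z
    using that V(6)
    by (simp add: upd_def f_Qv configs_fun_upd) (subst f_Tv_const, auto simp: configs_fun_upd)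
  have ell: "\<forall>v \<in> ?A \<union> set [Ell 1].
      upd_word f [Ell 1] (upd_word f ?u x) v = upd_word f [Ell 1] (upd_word f ?u y) v"
  proof (rule agree)
    show "determines G ?A [Ell 1]" using n_pos in_arcs_G(3)[of 1] by simp
    show "\<forall>v \<in> ?A. upd_word f ?u x v = upd_word f ?u y v"
      unfolding u[OF x] u[OF y] by simp
  qed (use V x y in \<open>auto simp del: upd_word.simps intro!: upd_word_configs\<close>)
  let ?x = "upd_word f ?v (upd_word f ?u x)" and ?y = "upd_word f ?v (upd_word f ?u y)"
  have xy: "?x \<in> configs V" "?y \<in> configs V"
    using V x y by (simp_all only: upd_word_configs)
  have "upd_word f ?v z v = upd_word f [Ell 1] z v" if "v \<noteq> Qv" "v \<noteq> Tv" for z v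
    using that by (simp add: upd_def)
  then have "\<forall>v \<in> ?A \<union> {Ell 1}. ?x v = ?y v" using ell by auto
  moreover have "?x Tv = ?y Tv"
    using V(1) x(1) y(1) Tv upd_word_configs by metis
  ultimately have eq: "\<forall>v \<in> ?A \<union> {Ell 1, Tv}. ?x v = ?y v" by auto
  \<comment> \<open>The two states may still differ at \<open>Ell 0\<close> and \<open>Qv\<close>;
    these are updated last, once \<open>Cv 1\<close> is determined.\<close>
  have det: "determines G (?A \<union> {Ell 1, Tv}) ?w"
    unfolding determines_append
  proof (intro conjI determines_chain determines_clause_word)
    show "Lit r b \<in> ?A \<union> {Ell 1, Tv} \<union> set (chain 2 n)" if "r \<in> {1..n}" for r b
      using that by (cases "r = 1"; cases b) (auto simp: set_chain)
    show "Ell n \<in> ?A \<union> {Ell 1, Tv} \<union> set (chain 2 n)"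
      using n_pos by (cases "n = 1") (auto simp: set_chain)
    show "determines G (?A \<union> {Ell 1, Tv} \<union> set (chain 2 n) \<union> set clause_word) [Ell 0, Qv]"
      using m_pos in_arcs_G(2,7) by (auto simp: set_clause_word)
  qed (use n_pos in auto)
  have "V \<subseteq> ?A \<union> {Ell 1, Tv} \<union> set ?w"
  proof
    fix v assume "v \<in> V"
    then have "v = Qv \<or> v = Tv \<or> v = Ell 0 \<or> v \<in> set sweep" by (auto simp: set_sweep)
    then show "v \<in> ?A \<union> {Ell 1, Tv} \<union> set ?w"
      unfolding sweep_split block_def by auto
  qed
  then have "upd_word f ?w ?x = upd_word f ?w ?y"
    by (rule agree_all[OF V(3) det xy eq])
  then show ?thesis
    by (simp add: collapse_def block_def upd_word_append)
qed

lemma synchronizes_sync_word: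
  assumes unique: "\<And>x y. fixed_point V f x \<Longrightarrow> fixed_point V f y \<Longrightarrow> x = y"
  shows "synchronizes V f sync_word"
proof -
  have start: "upd_word f sync_word x = upd_word f (skew @ collapse) (F (h (x (Ell 0))))"
    if "x \<in> configs V" for x
    using that by (simp add: sync_word_def upd_word_append upd_word_settle upd_word_turn)
  \<comment> \<open>The identity would make \<open>F True\<close> and \<open>F False\<close>
    distinct fixed points; the other maps on one bit are the constants and the negation.\<close>
  have "\<not> (h True \<and> \<not> h False)"
    using unique[OF fixed_point_F fixed_point_F, of True False] F_Ell_0 by metis
  then consider (const) k where "\<And>a. h a = k" | (neg) "\<And>a. h a \<longleftrightarrow> \<not> a"
    by (metis (full_types))
  then have "\<exists>y. \<forall>a. upd_word f (skew @ collapse) (F (h a)) = y"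
  proof cases
    case const
    then have "fixed_point V f (F k)" by (intro fixed_point_F)
    then have "upd_word f (skew @ collapse) (F k) = F k"
      using set_sync_word unfolding fixed_point_def
      by (intro upd_word_stable) (auto simp: sync_word_def)
    with const show ?thesis by simp
  next
    case neg
    let ?z = "\<lambda>a. (F (\<not> a))(Qv := \<not> a, Tv := \<not> a, Ell 0 := a)"
    have "upd_word f collapse (?z a) = upd_word f collapse (?z True)" for a
      by (rule upd_word_collapse) (auto simp: F_configs configs_fun_upd)
    then have "upd_word f (skew @ collapse) (F a) = upd_word f collapse (?z True)" for a
      using neg by (simp add: upd_word_append upd_word_skew)
    then show ?thesis by blast
  qed
  then show ?thesis
    unfolding synchronizes_def using set_sync_word start by metis
qed

section \<open>Fixed points and satisfying assignments\<close>

text \<open>\<open>settle\<close> does not move a fixed point, yet its result depends only on the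
  value at \<open>Ell 0\<close>.\<close>

lemma fixed_point_eqI:
  assumes "fixed_point V f x" and "fixed_point V f y" and "x (Ell 0) = y (Ell 0)"
  shows "x = y"
proof -
  have F: "F (z (Ell 0)) = z" if "fixed_point V f z" for z
    using that upd_word_settle[of z] upd_word_stable[of settle f z]
    by (simp add: fixed_point_def set_settle)
  have "F (x (Ell 0)) = F (y (Ell 0))" using assms(3) by simp
  then show ?thesis unfolding F[OF assms(1)] F[OF assms(2)] .
qed

lemma satisfiable_if_fixed_points:
  assumes x: "fixed_point V f x" and y: "fixed_point V f y"
    and x0: "x (Ell 0)" and y0: "\<not> y (Ell 0)"
  shows "satisfiable m cl"
proof -
  have cfg: "x \<in> configs V" "y \<in> configs V" and fx: "\<And>v. v \<in> V \<Longrightarrow> f x v = x v"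
    and fy: "\<And>v. v \<in> V \<Longrightarrow> f y v = y v"
    using x y by (auto simp: fixed_point_def)
  have q: "x Qv \<longleftrightarrow> \<not> x (Ell 0)" "y Qv \<longleftrightarrow> \<not> y (Ell 0)"
    using f_Qv[OF cfg(1)] f_Qv[OF cfg(2)] fx[of Qv] fy[of Qv] by simp_all
  have t: "x Tv = y Tv"
    using f_Tv_const[OF cfg(1) q(1)] f_Tv_const[OF cfg(2) q(2)] fx[of Tv] fy[of Tv] by simp
  \<comment> \<open>\<open>up\<close> marks a rise from \<open>y\<close> to \<open>x\<close>, as at
    \<open>Ell 0\<close>; \<open>le\<close> excludes a fall and is carried from \<open>Ell 0\<close>
    to every \<open>Mu s\<close>.\<close>
  define up where "up v \<longleftrightarrow> x v \<and> \<not> y v" for v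
  define le where "le v \<longleftrightarrow> (y v \<longrightarrow> x v)" for v
  have Tv: "le Tv" "\<not> up Tv" using t by (simp_all add: le_def up_def)
  \<comment> \<open>Conjunction and disjunction are monotone; they rise when both inputs rise, and
    do not rise when neither input does.\<close>
  have pos: "le v" "up u \<Longrightarrow> up w \<Longrightarrow> up v" "up v \<Longrightarrow> up u \<or> up w"
    if "gate V f v (u, 1) (w, 1)" "v \<in> V" "le u" "le w" for u v w
    using gate_two_configs[OF that(1) cfg] that(3,4)
    unfolding fx[OF that(2)] fy[OF that(2)] up_def le_def signed_simps by blast+
  have lit: "le (Lit r b)" "up (Lit r b) \<Longrightarrow> up (Ell (r - 1))"
    if r: "r \<in> {1..n}" and le: "le (Ell (r - 1))" for r b
  proof -
    have "Lit r b \<in> V" using r by simp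
    note pos' = pos[OF gates(1)[OF r] this le Tv(1)]
    show "le (Lit r b)" by (rule pos'(1))
    show "up (Ell (r - 1))" if "up (Lit r b)" using pos'(3)[OF that] Tv(2) by blast
  qed
  have ell: "le (Ell r)" if "r \<le> n" for r
    using that
  proof (induction r)
    case 0
    then show ?case using x0 by (simp add: le_def)
  next
    case (Suc r)
    then have "le (Lit (Suc r) b)" for b by (intro lit) auto
    then show ?case using pos(1)[OF gates(2)[of "Suc r"]] Suc.prems by simp
  qed
  have le_lit: "le (Lit r b)" if "r \<in> {1..n}" for r b
    using that ell by (intro lit) auto
  have le_clause: "le (lit_vtx (cl s k))" if "s \<in> {1..m}" "k \<in> {1..3}" for s k
    using wf that le_lit by (auto simp: wf_3cnf_def lit_vtx_def)
  have le_MuP: "le (MuP s)" if "s \<in> {1..m}" for s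
    using pos(1)[OF gates(3)[OF that]] le_clause that by simp
  have le_Mu: "le (Mu s)" if "s \<in> {1..m}" for s
    using pos(1)[OF gates(4)[OF that]] le_clause le_MuP that by simp
  \<comment> \<open>\<open>Mu s\<close> enters negated and does not fall, so a rise of
    \<open>Cv s\<close> must come from its other input. If \<open>Mu s\<close> rose as well, the
    gate would see opposite inputs at both points and not change.\<close>
  have cv_step: "\<not> up (Mu s) \<and> up (cv n m (Suc s))" if "s \<in> {1..m}" "up (Cv s)" for s
  proof -
    have V: "Cv s \<in> V" using that(1) by simp
    show ?thesis
      using gate_two_configs[OF gates(5)[OF that(1)] cfg] that(2) le_Mu[OF that(1)]
      unfolding fx[OF V] fy[OF V] up_def le_def signed_simps by blast
  qed
  \<comment> \<open>Index 0 stands for \<open>Cv 1\<close> and index \<open>m\<close> for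
    \<open>Ell n\<close>: the rise is traced backwards through the clause vertices.\<close>
  have up_cv: "up (cv n m (Suc s))" if "s \<le> m" for s
    using that
  proof (induction s)
    case 0
    have "up (Cv 1)"
      using x0 y0 f_Ell_0[OF cfg(1)] f_Ell_0[OF cfg(2)] fx[of "Ell 0"] fy[of "Ell 0"]
      by (simp add: up_def)
    then show ?case using m_pos by (simp add: cv_def)
  next
    case (Suc s)
    then have "up (Cv (Suc s))" by (simp add: cv_def)
    then show ?case using cv_step[of "Suc s"] Suc.prems by simp
  qed
  have not_up_Mu: "\<not> up (Mu s)" if "s \<in> {1..m}" for s
    using cv_step[OF that] up_cv[of "s - 1"] that by (cases s) (auto simp: cv_def)
  have "up (Ell n)" using up_cv[of m] by (simp add: cv_def)
  \<comment> \<open>A rise at \<open>Ell r\<close> needs a rising literal of variable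
    \<open>r\<close>, which needs a rise at \<open>Ell (r - 1)\<close> because \<open>Tv\<close>
    does not rise.\<close>
  then have up_ell: "up (Ell (n - k))" if "k \<le> n" for k
    using that
  proof (induction k)
    case (Suc k)
    let ?r = "n - k"
    have r: "?r \<in> {1..n}" using Suc.prems by auto
    have "up (Lit ?r True) \<or> up (Lit ?r False)"
      using pos(3)[OF gates(2)[OF r]] Suc le_lit[OF r] by simp
    then have "up (Ell (?r - 1))" using lit(2)[OF r] ell r by auto
    then show ?case by simp
  qed simp
  have up_lit: "up (Lit r True) \<or> up (Lit r False)" if "r \<in> {1..n}" for r
    using pos(3)[OF gates(2)[OF that]] up_ell[of "n - r"] le_lit[OF that] that by simp
  \<comment> \<open>Every literal false under \<open>z\<close> rises: a positive one by definition,
    a negative one by \<open>up_lit\<close>. The literals of an unsatisfied clause would therefore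
    push \<open>Mu s\<close> up.\<close>
  define z where "z r \<longleftrightarrow> \<not> up (Lit r True)" for r
  have up_unsat: "up (lit_vtx l)" if "fst l \<in> {1..n}" "z (fst l) \<noteq> snd l" for l
    using that up_lit[of "fst l"] by (cases l; cases "snd l") (auto simp: z_def lit_vtx_def)
  show ?thesis
    unfolding satisfiable_def
  proof (intro exI[of _ z] ballI, rule ccontr)
    fix s assume s: "s \<in> {1..m}" and no: "\<not> (\<exists>k \<in> {1..3}. z (fst (cl s k)) = snd (cl s k))"
    have up: "up (lit_vtx (cl s k))" if "k \<in> {1..3}" for k
      using wf s no that by (intro up_unsat) (auto simp: wf_3cnf_def)
    have "up (MuP s)" using pos(2)[OF gates(3)[OF s]] s up le_clause by simp
    then have "up (Mu s)" using pos(2)[OF gates(4)[OF s]] s up le_clause le_MuP by simp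
    then show False using not_up_Mu s by simp
  qed
qed

end

section \<open>Two fixed points from a satisfying assignment\<close>

context formula
begin

text \<open>While \<open>Tv\<close> is True, literals true under \<open>z\<close> are constantly
  True and the others copy \<open>Ell (r - 1)\<close>; hence \<open>Ell r\<close> copies
  \<open>Ell (r - 1)\<close>. Where \<open>Mu s\<close> is True, \<open>Cv s\<close> copies its
  other input.\<close>

fun sat_net :: "(nat \<Rightarrow> bool) \<Rightarrow> (vtx \<Rightarrow> bool) \<Rightarrow> vtx \<Rightarrow> bool" where
  "sat_net z x (Lit r b) = (if z r = b then x (Ell (r - 1)) \<or> x Tv else x (Ell (r - 1)) \<and> x Tv)"
| "sat_net z x (Ell r) = (if r = 0 then x (Cv 1) else x (Lit r True) \<and> x (Lit r False))"
| "sat_net z x (MuP s) = (x (lit_vtx (cl s 1)) \<or> x (lit_vtx (cl s 2)))"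
| "sat_net z x (Mu s) = (x (MuP s) \<or> x (lit_vtx (cl s 3)))"
| "sat_net z x (Cv s) = (\<not> x (Mu s) \<or> x (cv n m (Suc s)))"
| "sat_net z x Qv = (\<not> x (Ell 0))"
| "sat_net z x Tv = (x (Ell 0) \<or> x Qv)"

lemma BN_on_sat_net: "BN_on V G (sat_net z)"
  unfolding BN_on_iff gate_def by auto

text \<open>\<open>a\<close> is the value carried around the cycle through \<open>Ell 0\<close>;
  \<open>v \<in> V\<close> makes this a configuration.\<close>

definition sat_point :: "(nat \<Rightarrow> bool) \<Rightarrow> bool \<Rightarrow> vtx \<Rightarrow> bool" where
  "sat_point z a v \<longleftrightarrow> v \<in> V \<and> (case v of
      Lit r b \<Rightarrow> z r = b \<or> a
    | Ell r \<Rightarrow> a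
    | MuP s \<Rightarrow> z (fst (cl s 1)) = snd (cl s 1) \<or> z (fst (cl s 2)) = snd (cl s 2) \<or> a
    | Mu s \<Rightarrow> True
    | Cv s \<Rightarrow> a
    | Qv \<Rightarrow> \<not> a
    | Tv \<Rightarrow> True)"

lemma fixed_point_sat_net:
  assumes sat: "\<forall>s \<in> {1..m}. z (fst (cl s 1)) = snd (cl s 1) \<or>
    z (fst (cl s 2)) = snd (cl s 2) \<or> z (fst (cl s 3)) = snd (cl s 3)"
  shows "fixed_point V (sat_net z) (sat_point z a)"
proof -
  have lit: "sat_point z a (lit_vtx (cl s k)) \<longleftrightarrow> z (fst (cl s k)) = snd (cl s k) \<or> a"
    if "s \<in> {1..m}" "k \<in> {1..3}" for s k
    using clause_lit[OF that] by (simp add: sat_point_def lit_vtx_def)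
  have "\<forall>v \<in> V. sat_net z (sat_point z a) v = sat_point z a v"
    unfolding Ball_V_G sat_net.simps
  proof (intro conjI ballI allI, goal_cases)
    case (4 s)
    then show ?case using lit[OF 4] by (auto simp: sat_point_def)
  next
    \<comment> \<open>This is \<open>Mu s\<close>: for \<open>a\<close> False its value is True
      because \<open>z\<close> satisfies the clause.\<close>
    case (5 s)
    then show ?case using lit[OF 5] sat by (auto simp: sat_point_def)
  qed (use m_pos in \<open>auto simp: sat_point_def cv_def\<close>)
  then show ?thesis
    unfolding fixed_point_def by (simp add: configs_def sat_point_def)
qed

lemma distinct_fixed_points_if_satisfiable:
  assumes "satisfiable m cl"
  obtains f x y where "BN_on V G f" and "fixed_point V f x" and "fixed_point V f y" and "x \<noteq> y"
proof -
  obtain z where z: "\<forall>s \<in> {1..m}. z (fst (cl s 1)) = snd (cl s 1) \<or>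
    z (fst (cl s 2)) = snd (cl s 2) \<or> z (fst (cl s 3)) = snd (cl s 3)"
    using assms unfolding satisfiable_iff by blast
  have "sat_point z True (Ell 0) \<noteq> sat_point z False (Ell 0)" by (simp add: sat_point_def)
  then have "sat_point z True \<noteq> sat_point z False" by metis
  then show thesis
    using that BN_on_sat_net fixed_point_sat_net[OF z] by blast
qed

end

theorem theorem6:
  fixes n m :: nat and cl :: "nat \<Rightarrow> nat \<Rightarrow> nat \<times> bool"
  assumes "n \<ge> 2" and "m \<ge> 1" and "wf_3cnf n m cl"
  defines "V \<equiv> V_G n m" and "G \<equiv> G_psi n m cl"
  shows "(\<not> satisfiable m cl
            \<longleftrightarrow> (\<forall>f. BN_on V G f \<longrightarrow> (\<forall>x y. fixed_point V f x \<and> fixed_point V f y \<longrightarrow> x = y)))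
       \<and> ((\<forall>f. BN_on V G f \<longrightarrow> (\<forall>x y. fixed_point V f x \<and> fixed_point V f y \<longrightarrow> x = y))
            \<longleftrightarrow> (\<exists>w. length w = 12 * n + 12 * m + 11 \<and> (\<forall>f. BN_on V G f \<longrightarrow> synchronizes V f w)))
       \<and> ((\<exists>w. length w = 12 * n + 12 * m + 11 \<and> (\<forall>f. BN_on V G f \<longrightarrow> synchronizes V f w))
            \<longleftrightarrow> (\<forall>f. BN_on V G f \<longrightarrow> synchronizing V f))"
    (is "(\<not> ?sat \<longleftrightarrow> ?unique) \<and> (_ \<longleftrightarrow> ?word) \<and> (_ \<longleftrightarrow> ?sync)")
proof -
  interpret formula n m cl
    using assms(1-3) by unfold_locales auto
  have net: "network n m cl f" if "BN_on V G f" for f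
    using that by unfold_locales (simp add: V_def G_def)
  \<comment> \<open>Statements 1 and 2 are shown to imply each other, and 2 to 4 are linked by the
    cycle 2, 3, 4, 2.\<close>
  have "?unique" if "\<not> ?sat"
  proof (intro allI impI, elim conjE)
    fix f x y assume f: "BN_on V G f" and xy: "fixed_point V f x" "fixed_point V f y"
    interpret network n m cl f by (rule net[OF f])
    have "x (Ell 0) = y (Ell 0)"
      using satisfiable_if_fixed_points that xy unfolding V_def by metis
    then show "x = y" using fixed_point_eqI xy unfolding V_def by blast
  qed
  moreover have "\<not> ?sat" if "?unique"
    using that distinct_fixed_points_if_satisfiable unfolding V_def G_def by metis
  moreover have "?word" if "?unique"
  \<comment> \<open>\<open>sync_word\<close> is built before a network is chosen, so one word serves
    all of them.\<close>
  proof (intro exI[of _ sync_word] conjI allI impI)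
    fix f assume f: "BN_on V G f"
    interpret network n m cl f by (rule net[OF f])
    show "synchronizes V f sync_word"
      using synchronizes_sync_word that f unfolding V_def by blast
  qed (rule length_sync_word)
  moreover have "?sync" if "?word"
    using that unfolding synchronizing_def by blast
  moreover have "?unique" if "?sync"
    using that synchronizing_unique_fixed_point by blast
  ultimately show ?thesis by blast
qed

end
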